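(* Let $\rho\in(0,1)$, let $\Lambda\subset\mathbb Z^d$ be finite, and let $u:\mathcal X\to\mathbb R$ be integrable under $\mathbb P_\rho$. With $\alpha(\rho)=-\log(1-\rho)$, for every $i\in\{1,\dots,d\}$, $$\sum_{x\in\Lambda}\langle\!\langle\tilde\eta_x\,\tilde\pi_{x,x+e_i}[u]\rangle\!\rangle_{\alpha(\rho)}=\frac{\alpha(\rho)}{2\rho}\sum_{x\in\Lambda}\langle\nabla_{x,e_i}u\rangle_\rho.$$
   Context: $\mathcal X=\{0,1\}^{\mathbb Z^d}$ and $\mathbb P_\rho$, $\langle\cdot\rangle_\rho$ are the product Bernoulli measure of density $\rho$ and its expectation. $\eta^{x,y}$ is $\eta\in\mathcal X$ with values at $x,y$ exchanged, and $\nabla_{x,e_i}u(\eta)=(u(\eta^{x,x+e_i})-u(\eta))(\eta_x-\eta_{x+e_i})$, where $e_1,\dots,e_d$ is the canonical basis. $\tilde{\mathcal X}=\mathbb N^{\mathbb Z^d}$, $\mathbb N=\{0,1,2,\dots\}$; $\langle\!\langle\cdot\rangle\!\rangle_\alpha$ is the expectation under $\mathrm{Poi}(\alpha)^{\otimes\mathbb Z^d}$, with $\tilde\eta$ the canonical variable. For $\tilde\eta_x\ge1$ and $\tilde u:\tilde{\mathcal X}\to\mathbb R$, $(\tilde\pi_{x,y}\tilde u)(\tilde\eta)=\tilde u(\tilde\eta-\delta_x+\delta_y)-\tilde u(\tilde\eta)$ ($\delta_x$ denotes one particle at $x$); the product $\tilde\eta_x\tilde\pi_{x,y}\tilde u$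 is $0$ when $\tilde\eta_x=0$. For $u:\mathcal X\to\mathbb R$, $[u](\tilde\eta)=u([\tilde\eta])$ with $[\tilde\eta]_x=\mathbf 1_{\{\tilde\eta_x\ge1\}}$. *)

theory Defs
  imports "HOL-Probability.Probability"
begin

text \<open>The lattice $Z^d$ is \<^typ>\<open>int ^ 'd\<close>, with $e_i$ rendered as \<^term>\<open>axis i (1::int)\<close>.
  Exclusion configurations are boolean-valued, \<^term>\<open>True\<close> standing for an occupied site
  (occupation number 1), so that occupation numbers are read off with \<^const>\<open>of_bool\<close>.\<close>

type_synonym 'd site = "int ^ 'd"
type_synonym 'd config = "'d site \<Rightarrow> bool"
type_synonym 'd pconfig = "'d site \<Rightarrow> nat"

definition bernoulli_product :: "real \<Rightarrow> ('d::finite) config measure" where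
  "bernoulli_product \<rho> = (\<Pi>\<^sub>M x\<in>UNIV. measure_pmf (bernoulli_pmf \<rho>))"

definition poisson_product :: "real \<Rightarrow> ('d::finite) pconfig measure" where
  "poisson_product \<alpha> = (\<Pi>\<^sub>M x\<in>UNIV. measure_pmf (poisson_pmf \<alpha>))"

definition exchange :: "('d::finite) site \<Rightarrow> 'd site \<Rightarrow> 'd config \<Rightarrow> 'd config" where
  "exchange x y \<eta> = \<eta>(x := \<eta> y, y := \<eta> x)"

definition nabla ::
  "('d::finite) site \<Rightarrow> 'd site \<Rightarrow> ('d config \<Rightarrow> real) \<Rightarrow> 'd config \<Rightarrow> real" where
  "nabla x e u \<eta> = (u (exchange x (x + e) \<eta>) - u \<eta>) * (of_bool (\<eta> x) - of_bool (\<eta> (x + e)))"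

definition particle :: "('d::finite) site \<Rightarrow> 'd pconfig" where
  "particle x = (\<lambda>z. of_bool (z = x))"

text \<open>The subtraction is truncated, so this is the particle jump only if \<^term>\<open>\<eta> x \<ge> 1\<close>; in the
  products $\eta_x \pi_{x,y} u$ the value at \<^term>\<open>\<eta> x = 0\<close> is cancelled by the factor $0$.\<close>
definition jump_diff ::
  "('d::finite) site \<Rightarrow> 'd site \<Rightarrow> ('d pconfig \<Rightarrow> real) \<Rightarrow> 'd pconfig \<Rightarrow> real" where
  "jump_diff x y u \<eta> = u (\<lambda>z. \<eta> z - particle x z + particle y z) - u \<eta>"

definition occupied :: "('d::finite) pconfig \<Rightarrow> 'd config" where
  "occupied \<eta> = (\<lambda>x. \<eta> x \<ge> 1)"

definition lift_fun :: "(('d::finite) config \<Rightarrow> real) \<Rightarrow> 'd pconfig \<Rightarrow> real" where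
  "lift_fun u \<eta> = u (occupied \<eta>)"

definition alpha :: "real \<Rightarrow> real" where
  "alpha \<rho> = - ln (1 - \<rho>)"

end

theory Submission
  imports Defs
begin

text \<open>By the Mecke identity for the Poisson law, the left-hand integral at \<open>x\<close> is \<open>\<alpha>\<close> times the
  expectation of the increment caused by adding a particle at \<open>x + e\<^sub>i\<close> rather than at \<open>x\<close>. Since
  \<open>1 - exp (-\<alpha>(\<rho>)) = \<rho>\<close>, the occupation variables are Bernoulli of density \<open>\<rho>\<close>, so this is the
  Bernoulli expectation of \<open>u\<close> with \<open>x + e\<^sub>i\<close> filled minus \<open>u\<close> with \<open>x\<close> filled. Averaging over
  the values at both sites turns it into \<open>1 - \<rho>\<close> times the difference of the expectations of
  \<open>u\<close> with values \<open>(0,1)\<close> and \<open>(1,0)\<close> at \<open>(x, x + e\<^sub>i)\<close>; the gradient gives \<open>2\<rho>(1 - \<rho>)\<close> times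
  the same difference.\<close>

section \<open>Products of discrete laws\<close>

abbreviation pmf_product :: "('i \<Rightarrow> 'a pmf) \<Rightarrow> ('i \<Rightarrow> 'a) measure" where
  "pmf_product p \<equiv> PiM UNIV (\<lambda>x. measure_pmf (p x))"

lemma prob_space_pmf_product: "prob_space (pmf_product p)"
  by (intro prob_space_PiM prob_space_measure_pmf)

text \<open>The criterion refers only to the discrete sigma-algebra on each coordinate, never to the
  laws, so it also covers maps between products with different marginals, such as
  \<open>occupied\<close>.\<close>

lemma measurable_into_pmf_product:
  assumes "\<And>x. (\<lambda>\<omega>. f \<omega> x) \<in> measurable N (count_space UNIV)"
  shows "f \<in> measurable N (pmf_product p)"
proof -
  have "(\<lambda>\<omega> x. f \<omega> x) \<in> measurable N (pmf_product p)"
  proof (rule measurable_PiM_single')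
    show "(\<lambda>\<omega>. f \<omega> x) \<in> measurable N (measure_pmf (p x))" for x
      using assms[of x] measurable_cong_sets[OF refl sets_measure_pmf_count_space] by blast
  qed (auto simp: space_PiM)
  then show ?thesis by simp
qed

lemma measurable_coordinate:
  "(\<lambda>\<eta>. \<eta> x) \<in> measurable (pmf_product p) (count_space UNIV)"
proof -
  have "(\<lambda>\<eta>. \<eta> x) \<in> measurable (pmf_product p) (measure_pmf (p x))"
    by (rule measurable_component_singleton) simp
  then show ?thesis by simp
qed

lemma measurable_of_coordinate [measurable]:
  "(\<lambda>\<eta>. g (\<eta> x)) \<in> measurable (pmf_product p) (count_space UNIV)"
  by (rule measurable_compose[OF measurable_coordinate]) simp

lemma measurable_update_coordinate [measurable]:
  "(\<lambda>\<eta>. \<eta>(x := g (\<eta> x))) \<in> measurable (pmf_product p) (pmf_product p)"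
  by (rule measurable_into_pmf_product) (auto simp: fun_upd_def)

lemma measurable_update_pair:
  "(\<lambda>(a, \<eta>). \<eta>(x := a)) \<in> measurable (measure_pmf q \<Otimes>\<^sub>M pmf_product p) (pmf_product p)"
  (is "?F \<in> measurable ?N _")
proof (rule measurable_into_pmf_product)
  fix z
  have *: "fst \<in> measurable ?N (count_space UNIV)"
    using measurable_fst[of "measure_pmf q" "pmf_product p"] by simp
  have **: "(\<lambda>\<omega>. snd \<omega> z) \<in> measurable ?N (count_space UNIV)"
    by (rule measurable_compose[OF measurable_snd measurable_coordinate])
  show "(\<lambda>\<omega>. ?F \<omega> z) \<in> measurable ?N (count_space UNIV)"
    using * ** by (cases "z = x") (simp_all add: split_beta)
qed

text \<open>The coordinates are independent, so overwriting one of them by a fresh sample of its own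
  law is invisible in distribution. With Tonelli or Fubini this allows integrating out a single site
  first.\<close>

lemma distr_resample_coordinate:
  "distr (measure_pmf (p x) \<Otimes>\<^sub>M pmf_product p) (pmf_product p) (\<lambda>(a, \<eta>). \<eta>(x := a)) = pmf_product p"
  using distr_pair_PiM_eq_PiM[of UNIV "\<lambda>x. measure_pmf (p x)" x]
  by (simp add: prob_space_measure_pmf)

lemma nn_integral_resample_coordinate:
  assumes [measurable]: "f \<in> borel_measurable (pmf_product p)"
  shows "(\<integral>\<^sup>+\<eta>. f \<eta> \<partial>pmf_product p)
       = (\<integral>\<^sup>+\<eta>. \<integral>\<^sup>+a. f (\<eta>(x := a)) \<partial>measure_pmf (p x) \<partial>pmf_product p)"
proof -
  interpret P: prob_space "pmf_product p" by (rule prob_space_pmf_product)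
  interpret pair_sigma_finite "measure_pmf (p x)" "pmf_product p" ..
  note measurable_update_pair[measurable]
  have "(\<integral>\<^sup>+\<eta>. f \<eta> \<partial>pmf_product p)
      = (\<integral>\<^sup>+\<omega>. f ((\<lambda>(a, \<eta>). \<eta>(x := a)) \<omega>) \<partial>(measure_pmf (p x) \<Otimes>\<^sub>M pmf_product p))"
    by (subst distr_resample_coordinate[of p x, symmetric]) (rule nn_integral_distr; measurable)
  also have "\<dots> = (\<integral>\<^sup>+\<eta>. \<integral>\<^sup>+a. f (\<eta>(x := a)) \<partial>measure_pmf (p x) \<partial>pmf_product p)"
    by (subst nn_integral_snd[symmetric]) simp_all
  finally show ?thesis .
qed

text \<open>A product measure is determined by its values on finite cylinders, and the preimage of a
  cylinder under a coordinatewise map is the cylinder over the preimages of its sides.\<close>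

lemma distr_map_coordinates:
  fixes p :: "'i \<Rightarrow> 'a pmf" and g :: "'a \<Rightarrow> 'c"
  shows "distr (pmf_product p) (pmf_product (\<lambda>x. map_pmf g (p x))) (\<lambda>\<eta> x. g (\<eta> x))
     = pmf_product (\<lambda>x. map_pmf g (p x))"
  (is "distr ?P ?Q ?G = _")
proof -
  interpret P: product_prob_space "\<lambda>x. measure_pmf (p x)" UNIV
    by (rule product_prob_spaceI) (rule prob_space_measure_pmf)
  interpret Q: product_prob_space "\<lambda>x. measure_pmf (map_pmf g (p x))" UNIV
    by (rule product_prob_spaceI) (rule prob_space_measure_pmf)
  have G [measurable]: "?G \<in> measurable ?P ?Q"
    by (rule measurable_into_pmf_product) measurable
  show ?thesis
  proof (rule Q.PiM_eq)
    fix J :: "'i set" and A :: "'i \<Rightarrow> 'c set"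
    assume J: "finite J"
    have *: "?G -` prod_emb UNIV (\<lambda>x. measure_pmf (map_pmf g (p x))) J (Pi\<^sub>E J A) \<inter> space ?P
        = prod_emb UNIV (\<lambda>x. measure_pmf (p x)) J (Pi\<^sub>E J (\<lambda>x. g -` A x))"
      by (auto simp: prod_emb_def space_PiM PiE_iff extensional_def)
    show "emeasure (distr ?P ?Q ?G)
        (prod_emb UNIV (\<lambda>x. measure_pmf (map_pmf g (p x))) J (Pi\<^sub>E J A))
        = (\<Prod>x\<in>J. emeasure (measure_pmf (map_pmf g (p x))) (A x))"
      by (subst emeasure_distr) (simp_all add: * J P.emeasure_PiM_emb sets_PiM_I)
  qed simp
qed

section \<open>The Mecke identity for independent Poisson variables\<close>

text \<open>This rests on the recursion (n + 1) p(n + 1) = \<alpha> p(n) for the Poisson weights;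
  the term n = 0 drops out because of the factor n, which permits the index shift.\<close>

lemma nn_integral_poisson_mecke:
  assumes "0 < \<alpha>"
  shows "(\<integral>\<^sup>+n. of_nat n * g n \<partial>measure_pmf (poisson_pmf \<alpha>))
       = ennreal \<alpha> * (\<integral>\<^sup>+n. g (Suc n) \<partial>measure_pmf (poisson_pmf \<alpha>))"
proof -
  let ?p = "\<lambda>n. ennreal (pmf (poisson_pmf \<alpha>) n)"
  have step: "?p (Suc n) * of_nat (Suc n) = ennreal \<alpha> * ?p n" for n
  proof -
    have "pmf (poisson_pmf \<alpha>) (Suc n) * real (Suc n) = \<alpha> * pmf (poisson_pmf \<alpha>) n"
      using assms by (simp add: fact_Suc divide_simps del: of_nat_Suc)
    then show ?thesis
      using assms by (simp add: ennreal_of_nat_eq_real_of_nat flip: ennreal_mult del: pmf_poisson of_nat_Suc)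
  qed
  have "(\<integral>\<^sup>+n. of_nat n * g n \<partial>measure_pmf (poisson_pmf \<alpha>)) = (\<Sum>n. ?p n * (of_nat n * g n))"
    by (simp only: nn_integral_measure_pmf nn_integral_count_space_nat)
  also have "\<dots> = (\<Sum>n. ?p (Suc n) * (of_nat (Suc n) * g (Suc n)))"
    by (subst suminf_offset[where i=1]) (simp_all del: pmf_poisson)
  also have "\<dots> = (\<Sum>n. ennreal \<alpha> * (?p n * g (Suc n)))"
    by (simp only: mult.assoc[symmetric] step)
  also have "\<dots> = ennreal \<alpha> * (\<integral>\<^sup>+n. g (Suc n) \<partial>measure_pmf (poisson_pmf \<alpha>))"
    by (simp only: nn_integral_measure_pmf nn_integral_count_space_nat ennreal_suminf_cmult)
  finally show ?thesis .
qed

text \<open>As an identity of measures, Mecke's formula transfers to Bochner integrals without any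
  integrability assumption.\<close>
lemma density_poisson_mecke:
  fixes x :: 'i
  assumes "0 < \<alpha>"
  defines "P \<equiv> pmf_product (\<lambda>_::'i. poisson_pmf \<alpha>)"
  shows "density P (\<lambda>\<eta>. ennreal (real (\<eta> x)))
       = density (distr P P (\<lambda>\<eta>. \<eta>(x := Suc (\<eta> x)))) (\<lambda>_. ennreal \<alpha>)"
proof (rule measure_eqI)
  fix A assume "A \<in> sets (density P (\<lambda>\<eta>. ennreal (real (\<eta> x))))"
  then have A [measurable]: "A \<in> sets P" by simp
  have T [measurable]: "(\<lambda>\<eta>. \<eta>(x := Suc (\<eta> x))) \<in> measurable P P"
    unfolding P_def by measurable
  have U [measurable]: "(\<lambda>\<eta>. \<eta>(x := n)) \<in> measurable P P" for n
    unfolding P_def by (rule measurable_update_coordinate)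
  have c [measurable]: "(\<lambda>\<eta>. of_nat (\<eta> x) :: ennreal) \<in> borel_measurable P"
    unfolding P_def by measurable
  have res: "(\<integral>\<^sup>+\<eta>. f \<eta> \<partial>P) = (\<integral>\<^sup>+\<eta>. \<integral>\<^sup>+n. f (\<eta>(x := n)) \<partial>poisson_pmf \<alpha> \<partial>P)"
    if "f \<in> borel_measurable P" for f
    using nn_integral_resample_coordinate[of f "\<lambda>_. poisson_pmf \<alpha>" x] that unfolding P_def by simp
  have "emeasure (density P (\<lambda>\<eta>. ennreal (real (\<eta> x)))) A = (\<integral>\<^sup>+\<eta>. of_nat (\<eta> x) * indicator A \<eta> \<partial>P)"
    using A c by (simp add: emeasure_density flip: ennreal_of_nat_eq_real_of_nat)
  also have "\<dots> = (\<integral>\<^sup>+\<eta>. \<integral>\<^sup>+n. of_nat n * indicator A (\<eta>(x := n)) \<partial>poisson_pmf \<alpha> \<partial>P)"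
    by (subst res) simp_all
  also have "\<dots> = (\<integral>\<^sup>+\<eta>. ennreal \<alpha> * \<integral>\<^sup>+n. indicator A (\<eta>(x := Suc n)) \<partial>poisson_pmf \<alpha> \<partial>P)"
    by (simp only: nn_integral_poisson_mecke[OF assms(1)])
  also have "\<dots> = (\<integral>\<^sup>+\<eta>. \<integral>\<^sup>+n. ennreal \<alpha> * indicator A (\<eta>(x := Suc n)) \<partial>poisson_pmf \<alpha> \<partial>P)"
    by (simp add: nn_integral_cmult)
  \<comment> \<open>Resampling is undone here: setting site x to n before applying the map that adds
    a particle at x yields exactly \<open>\<eta>(x := Suc n)\<close>.\<close>
  also have "\<dots> = (\<integral>\<^sup>+\<eta>. ennreal \<alpha> * indicator A (\<eta>(x := Suc (\<eta> x))) \<partial>P)"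
    by (subst res[of "\<lambda>\<eta>. ennreal \<alpha> * indicator A (\<eta>(x := Suc (\<eta> x)))"]) simp_all
  also have "\<dots> = emeasure (density (distr P P (\<lambda>\<eta>. \<eta>(x := Suc (\<eta> x)))) (\<lambda>_. ennreal \<alpha>)) A"
    by (simp add: emeasure_density nn_integral_distr)
  finally show "emeasure (density P (\<lambda>\<eta>. ennreal (real (\<eta> x)))) A
    = emeasure (density (distr P P (\<lambda>\<eta>. \<eta>(x := Suc (\<eta> x)))) (\<lambda>_. ennreal \<alpha>)) A" .
qed simp

text \<open>Equality of the two weighted measures makes the integrands integrable simultaneously; if
  they are not, both Bochner integrals are 0 by convention and the identity persists.\<close>

lemma integral_poisson_mecke:
  fixes x :: 'i and f :: "('i \<Rightarrow> nat) \<Rightarrow> real"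
  assumes "0 < \<alpha>"
    and f [measurable]: "f \<in> borel_measurable (pmf_product (\<lambda>_. poisson_pmf \<alpha>))"
  shows "(\<integral>\<eta>. real (\<eta> x) * f \<eta> \<partial>pmf_product (\<lambda>_. poisson_pmf \<alpha>))
       = \<alpha> * (\<integral>\<eta>. f (\<eta>(x := Suc (\<eta> x))) \<partial>pmf_product (\<lambda>_. poisson_pmf \<alpha>))"
    (is "integral\<^sup>L ?P _ = _")
proof -
  let ?T = "\<lambda>\<eta>. \<eta>(x := Suc (\<eta> x))"
  have T [measurable]: "?T \<in> measurable ?P ?P" by measurable
  have "(\<integral>\<eta>. real (\<eta> x) * f \<eta> \<partial>?P) = integral\<^sup>L (density ?P (\<lambda>\<eta>. ennreal (real (\<eta> x)))) f"
    by (subst integral_density) simp_all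
  also have "\<dots> = (\<integral>\<eta>. \<alpha> * f \<eta> \<partial>distr ?P ?P ?T)"
    unfolding density_poisson_mecke[OF assms(1)] using assms(1)
    by (subst integral_density) simp_all
  also have "\<dots> = \<alpha> * (\<integral>\<eta>. f (?T \<eta>) \<partial>?P)"
    by (subst integral_distr) simp_all
  finally show ?thesis .
qed

section \<open>Conditioning Bernoulli variables on the value at a site\<close>

lemma bernoulli_resample:
  fixes f :: "('i \<Rightarrow> bool) \<Rightarrow> real"
  assumes \<rho>: "0 < \<rho>" "\<rho> < 1"
    and f: "integrable (pmf_product (\<lambda>_. bernoulli_pmf \<rho>)) f"
  shows integrable_bernoulli_fix: "integrable (pmf_product (\<lambda>_. bernoulli_pmf \<rho>)) (\<lambda>\<eta>. f (\<eta>(x := b)))"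
    and integral_bernoulli_resample: "integral\<^sup>L (pmf_product (\<lambda>_. bernoulli_pmf \<rho>)) f
      = \<rho> * (\<integral>\<eta>. f (\<eta>(x := True)) \<partial>pmf_product (\<lambda>_. bernoulli_pmf \<rho>))
        + (1 - \<rho>) * (\<integral>\<eta>. f (\<eta>(x := False)) \<partial>pmf_product (\<lambda>_. bernoulli_pmf \<rho>))"
proof -
  let ?B = "measure_pmf (bernoulli_pmf \<rho>)"
  let ?P = "pmf_product (\<lambda>_::'i. bernoulli_pmf \<rho>)"
  interpret P: prob_space ?P by (rule prob_space_pmf_product)
  interpret pair_sigma_finite ?B ?P ..
  let ?F = "\<lambda>(a, \<eta>). \<eta>(x := a)"
  note F [measurable] = measurable_update_pair[where p = "\<lambda>_. bernoulli_pmf \<rho>" and x = x]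
  have D: "distr (?B \<Otimes>\<^sub>M ?P) ?P ?F = ?P"
    by (rule distr_resample_coordinate)
  have fm [measurable]: "f \<in> borel_measurable ?P" using f by simp
  have "integrable (?B \<Otimes>\<^sub>M ?P) (\<lambda>\<omega>. f (?F \<omega>))"
    using f by (subst (asm) D[symmetric]) (simp add: integrable_distr_eq)
  then have int: "integrable (?B \<Otimes>\<^sub>M ?P) (\<lambda>(a, \<eta>). f (\<eta>(x := a)))"
    by (simp add: case_prod_unfold)
  have "AE a in ?B. integrable ?P (\<lambda>\<eta>. f (\<eta>(x := a)))"
    using AE_integrable_fst'[OF int] by simp
  \<comment> \<open>Both values have positive mass because 0 < \<rho> < 1, so a property of almost
    every value a holds for each value.\<close>
  then show "integrable ?P (\<lambda>\<eta>. f (\<eta>(x := b)))"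
    using \<rho> by (simp add: AE_measure_pmf_iff set_pmf_bernoulli)
  have "integral\<^sup>L ?P f = (\<integral>\<omega>. f (?F \<omega>) \<partial>(?B \<Otimes>\<^sub>M ?P))"
    by (subst D[symmetric], rule integral_distr) measurable
  also have "\<dots> = (\<integral>a. \<integral>\<eta>. f (\<eta>(x := a)) \<partial>?P \<partial>?B)"
    using integral_fst'[OF int] by (simp add: case_prod_unfold)
  also have "\<dots> = \<rho> * (\<integral>\<eta>. f (\<eta>(x := True)) \<partial>?P) + (1 - \<rho>) * (\<integral>\<eta>. f (\<eta>(x := False)) \<partial>?P)"
    using \<rho> by (simp add: integral_bernoulli_pmf)
  finally show "integral\<^sup>L ?P f
      = \<rho> * (\<integral>\<eta>. f (\<eta>(x := True)) \<partial>?P) + (1 - \<rho>) * (\<integral>\<eta>. f (\<eta>(x := False)) \<partial>?P)" .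
qed

lemma integral_nabla:
  fixes u :: "('d::finite) config \<Rightarrow> real"
  assumes \<rho>: "0 < \<rho>" "\<rho> < 1" and u: "integrable (bernoulli_product \<rho>) u" and e: "e \<noteq> 0"
  shows "(\<integral>\<eta>. nabla x e u \<eta> \<partial>bernoulli_product \<rho>)
       = 2 * \<rho> * (\<integral>\<eta>. u (\<eta>(x + e := True)) - u (\<eta>(x := True)) \<partial>bernoulli_product \<rho>)"
proof -
  define y where "y = x + e"
  have xy: "x \<noteq> y" using e by (simp add: y_def)
  let ?P = "pmf_product (\<lambda>_::'d site. bernoulli_pmf \<rho>)"
  have P: "bernoulli_product \<rho> = ?P" by (simp add: bernoulli_product_def)
  have u': "integrable ?P u" using u by (simp add: P)
  note fix1 = integrable_bernoulli_fix[OF \<rho>]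
  note res = integral_bernoulli_resample[OF \<rho>]
  \<comment> \<open>\<open>v a b\<close> is u with the values at x and y frozen to a and b. It no
    longer depends on those two coordinates, so later resampling at x or y leaves it
    unchanged.\<close>
  define v where "v a b = (\<lambda>\<eta>. u (\<eta>(x := a, y := b)))" for a b
  have v [intro]: "integrable ?P (v a b)" for a b
    unfolding v_def using fix1[OF fix1[OF u', of y b], of x a] by simp
  have vx: "v a b (\<eta>(x := c)) = v a b \<eta>" "v a b (\<eta>(y := c)) = v a b \<eta>" for a b c \<eta>
    using xy by (simp_all add: v_def fun_upd_twist)
  \<comment> \<open>The gradient vanishes when the two sites agree. For values (0,1) and (1,0) the
    exchange and the sign factor change together, so both cases give the same difference of frozen
    functions.\<close>
  let ?w = "\<lambda>\<eta>. of_bool (\<eta> x \<noteq> \<eta> y) * (v False True \<eta> - v True False \<eta>)"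
  have [measurable]: "Measurable.pred ?P (\<lambda>\<eta>. \<eta> x \<noteq> \<eta> y)"
    by measurable
  have w: "nabla x e u = ?w"
  proof
    fix \<eta> :: "'d config"
    have "u \<eta> = v (\<eta> x) (\<eta> y) \<eta>" by (simp add: v_def)
    moreover have "u (exchange x y \<eta>) = v (\<eta> y) (\<eta> x) \<eta>" by (simp add: v_def exchange_def)
    ultimately show "nabla x e u \<eta> = ?w \<eta>"
      by (cases "\<eta> x"; cases "\<eta> y") (simp_all add: nabla_def flip: y_def)
  qed
  have wi: "integrable ?P ?w"
  proof (rule Bochner_Integration.integrable_bound)
    show "integrable ?P (\<lambda>\<eta>. v False True \<eta> - v True False \<eta>)" by auto
    show "?w \<in> borel_measurable ?P" using v[THEN borel_measurable_integrable] by measurable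
  qed auto
  let ?h = "\<lambda>a b. integral\<^sup>L ?P (v a b)"
  \<comment> \<open>Once site x has value c, the indicator forces the opposite value at y, which has
    probability 1 - \<rho> for c = 1 and \<rho> for c = 0. Averaging over c then gives the factor
    2\<rho>(1 - \<rho>).\<close>
  have w_fix: "(\<integral>\<eta>. ?w (\<eta>(x := c)) \<partial>?P) = (if c then 1 - \<rho> else \<rho>) * (?h False True - ?h True False)" for c
    using res[OF fix1[OF wi, of x c], of y] xy by (cases c) (simp_all add: vx Bochner_Integration.integral_diff v)
  have "integral\<^sup>L ?P ?w = 2 * \<rho> * (1 - \<rho>) * (?h False True - ?h True False)"
    unfolding res[OF wi, of x] w_fix by (simp add: algebra_simps)
  \<comment> \<open>Filling y leaves x random, and filling x leaves y random. Both expansions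
    contain the same term \<rho> \<open>?h True True\<close>, which cancels in the difference and
    leaves the factor 1 - \<rho>.\<close>
  moreover have "(\<integral>\<eta>. u (\<eta>(y := True)) \<partial>?P) = \<rho> * ?h True True + (1 - \<rho>) * ?h False True"
    unfolding v_def by (rule res[OF fix1[OF u']])
  moreover have "(\<integral>\<eta>. u (\<eta>(x := True)) \<partial>?P) = \<rho> * ?h True True + (1 - \<rho>) * ?h True False"
    unfolding v_def using res[OF fix1[OF u', of x True], of y] xy by (simp add: fun_upd_twist)
  moreover have "(\<integral>\<eta>. u (\<eta>(y := True)) - u (\<eta>(x := True)) \<partial>?P)
      = (\<integral>\<eta>. u (\<eta>(y := True)) \<partial>?P) - (\<integral>\<eta>. u (\<eta>(x := True)) \<partial>?P)"
    by (intro Bochner_Integration.integral_diff fix1 u')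
  ultimately show ?thesis
    unfolding P w y_def[symmetric] by (simp only:) (simp (no_asm) add: algebra_simps)
qed

section \<open>From Poisson to Bernoulli variables\<close>

text \<open>The choice of \<open>alpha\<close> makes the Poisson mass at 0 equal to
  exp(-\<alpha>(\<rho>)) = 1 - \<rho>, and a law on the booleans is determined by its mass at
  \<open>False\<close>.\<close>

lemma map_poisson_occupied:
  assumes "0 < \<rho>" "\<rho> < 1"
  shows "map_pmf (\<lambda>n. n \<ge> 1) (poisson_pmf (alpha \<rho>)) = bernoulli_pmf \<rho>"
proof (rule pmf_eqI)
  have a: "0 < alpha \<rho>" using assms by (simp add: alpha_def)
  have F: "pmf (map_pmf (\<lambda>n. n \<ge> 1) (poisson_pmf (alpha \<rho>))) False = 1 - \<rho>"
  proof -
    have "(\<lambda>n::nat. n \<ge> 1) -` {False} = {0}" by auto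
    then show ?thesis
      using assms a by (simp add: pmf_map measure_pmf_single alpha_def)
  qed
  have T: "pmf q True = 1 - pmf q False" for q :: "bool pmf"
    using pmf_False_conv_True[of q] by simp
  show "pmf (map_pmf (\<lambda>n. n \<ge> 1) (poisson_pmf (alpha \<rho>))) b = pmf (bernoulli_pmf \<rho>) b" for b
    using F assms by (cases b) (simp_all add: T)
qed

lemma integral_jump_diff:
  fixes u :: "('d::finite) config \<Rightarrow> real"
  assumes \<rho>: "0 < \<rho>" "\<rho> < 1" and u: "u \<in> borel_measurable (bernoulli_product \<rho>)" and xy: "x \<noteq> y"
  shows "(\<integral>\<eta>. real (\<eta> x) * jump_diff x y (lift_fun u) \<eta> \<partial>poisson_product (alpha \<rho>))
       = alpha \<rho> * (\<integral>\<eta>. u (\<eta>(y := True)) - u (\<eta>(x := True)) \<partial>bernoulli_product \<rho>)"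
proof -
  let ?Q = "pmf_product (\<lambda>_::'d site. poisson_pmf (alpha \<rho>))"
  let ?P = "pmf_product (\<lambda>_::'d site. bernoulli_pmf \<rho>)"
  have a: "0 < alpha \<rho>" using \<rho> by (simp add: alpha_def)
  have [measurable]: "u \<in> borel_measurable ?P" using u by (simp add: bernoulli_product_def)
  have occ [measurable]: "occupied \<in> measurable ?Q ?P"
    unfolding occupied_def by (rule measurable_into_pmf_product) measurable
  have D: "distr ?Q ?P occupied = ?P"
    using distr_map_coordinates[of "\<lambda>_::'d site. poisson_pmf (alpha \<rho>)" "\<lambda>n. n \<ge> 1"]
    unfolding map_poisson_occupied[OF \<rho>] occupied_def .
  have move [measurable]: "(\<lambda>\<eta> z. \<eta> z - particle x z + particle y z) \<in> measurable ?Q ?Q"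
    by (rule measurable_into_pmf_product) measurable
  have f: "jump_diff x y (lift_fun u) \<in> borel_measurable ?Q"
    unfolding jump_diff_def[abs_def] lift_fun_def by measurable
  \<comment> \<open>After the Mecke shift the added particle at x is the one that jumps: the
    truncated subtraction is exact and removes just that particle, so the jump amounts to adding one
    at y to the original configuration.\<close>
  have *: "jump_diff x y (lift_fun u) (\<eta>(x := Suc (\<eta> x)))
      = u ((occupied \<eta>)(y := True)) - u ((occupied \<eta>)(x := True))" for \<eta>
  proof -
    have "occupied (\<lambda>z. (\<eta>(x := Suc (\<eta> x))) z - particle x z + particle y z) = (occupied \<eta>)(y := True)"
      using xy by (auto simp: occupied_def particle_def fun_eq_iff)
    moreover have "occupied (\<eta>(x := Suc (\<eta> x))) = (occupied \<eta>)(x := True)"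
      by (auto simp: occupied_def)
    ultimately show ?thesis
      unfolding jump_diff_def lift_fun_def by simp
  qed
  have "(\<integral>\<eta>. real (\<eta> x) * jump_diff x y (lift_fun u) \<eta> \<partial>?Q)
      = alpha \<rho> * (\<integral>\<eta>. u ((occupied \<eta>)(y := True)) - u ((occupied \<eta>)(x := True)) \<partial>?Q)"
    unfolding integral_poisson_mecke[OF a f] * ..
  \<comment> \<open>The integrand now depends on the Poisson configuration only through its occupied
    sites, whose law is the Bernoulli product.\<close>
  also have "(\<integral>\<eta>. u ((occupied \<eta>)(y := True)) - u ((occupied \<eta>)(x := True)) \<partial>?Q)
      = (\<integral>\<eta>. u (\<eta>(y := True)) - u (\<eta>(x := True)) \<partial>distr ?Q ?P occupied)"
    by (rule integral_distr[symmetric]) measurable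
  finally show ?thesis
    by (simp add: D poisson_product_def bernoulli_product_def)
qed

theorem proposition3p2:
  fixes \<rho> :: real and \<Lambda> :: "(int ^ 'd::finite) set" and u :: "(int ^ 'd \<Rightarrow> bool) \<Rightarrow> real"
    and i :: 'd
  assumes "0 < \<rho>" and "\<rho> < 1"
    and "finite \<Lambda>"
    and "integrable (bernoulli_product \<rho>) u"
  shows "(\<Sum>x\<in>\<Lambda>. \<integral>\<eta>. real (\<eta> x) * jump_diff x (x + axis i 1) (lift_fun u) \<eta>
            \<partial>poisson_product (alpha \<rho>))
       = alpha \<rho> / (2 * \<rho>) * (\<Sum>x\<in>\<Lambda>. \<integral>\<eta>. nabla x (axis i 1) u \<eta> \<partial>bernoulli_product \<rho>)"
proof -
  have e: "axis i (1::int) \<noteq> 0" by (simp add: axis_eq_0_iff)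
  \<comment> \<open>The identity holds site by site: both sides are multiples of the same Bernoulli
    integral, and dividing out the factor 2\<rho> of the gradient produces the constant. That e is
    nonzero makes the two sites distinct.\<close>
  have "(\<integral>\<eta>. real (\<eta> x) * jump_diff x (x + axis i 1) (lift_fun u) \<eta> \<partial>poisson_product (alpha \<rho>))
      = alpha \<rho> / (2 * \<rho>) * (\<integral>\<eta>. nabla x (axis i 1) u \<eta> \<partial>bernoulli_product \<rho>)" for x
    using integral_jump_diff[OF assms(1,2) borel_measurable_integrable[OF assms(4)], of x "x + axis i 1"]
      integral_nabla[OF assms(1,2,4) e, of x] e assms(1)
    by simp
  then show ?thesis by (simp add: sum_distrib_left)
qed

end
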